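(* Let $\mathbb{K}$ be a field and let $m_1,m_2,m_3,m_4$ be non-negative integers. The number of dominant monomial ideals in $\mathbb{K}[x_1,x_2,x_3,x_4]$ whose lcm is $x_1^{m_1}x_2^{m_2}x_3^{m_3}x_4^{m_4}$ is $$\begin{aligned} &1+(m_1m_2m_3m_4)^3+\sum_{1\le i<j\le 4}m_im_j\\ &+3(m_1m_2m_3+m_1m_2m_4+m_1m_3m_4+m_2m_3m_4)\\ &+7m_1m_2m_3m_4+(m_1m_2m_3)^2+(m_1m_2m_4)^2+(m_1m_3m_4)^2+(m_2m_3m_4)^2\\ &+6(m_1m_2m_3m_4)^2+3(m_1m_2^2m_3^2m_4^2+m_1^2m_2m_3^2m_4^2+m_1^2m_2^2m_3m_4^2+m_1^2m_2^2m_3^2m_4). \end{aligned}$$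
   Context: Let $S$ be a polynomial ring over a field in finitely many variables. For a monomial $u$ and a variable $x_i$, $\deg_{x_i}u$ denotes the exponent of $x_i$ in $u$. For a monomial ideal $I$, $G(I)$ denotes its unique minimal set of monomial generators. A monomial $v$ in a finite set $L$ of monomials is dominant in $L$ if there is a variable $x_i$ with $\deg_{x_i}v>\deg_{x_i}w$ for all $w\in L\setminus\{v\}$. The set $L$ is a dominant set if every element of $L$ is dominant in $L$ (in particular, a one-element set is dominant), and $I$ is a dominant ideal if $G(I)$ is a dominant set. The lcm of a nonzero monomial ideal $I$ is the least common multiple of the elements of $G(I)$; the zero ideal is not assigned an lcm and is not counted. *)

theory Defs
  imports Complex_Main "HOL-Library.Poly_Mapping" "HOL-Library.Numeral_Type"
begin

text \<open>
  A polynomial ring over \<open>'k\<close> with variables indexed by \<open>'x\<close> is rendered as the monoid algebra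
  \<open>('x \<Rightarrow>\<^sub>0 nat) \<Rightarrow>\<^sub>0 'k\<close> with its convolution product. A monomial \<open>u\<close> is given by its
  exponent vector, so that \<open>lookup u i\<close> is its degree in the variable \<open>i\<close>, products of
  monomials are sums of exponent vectors, and \<open>monom u\<close> is the monomial as a ring element.
  The order on \<open>'x \<Rightarrow>\<^sub>0 nat\<close> provided by the library is lexicographic and is not used.
\<close>

type_synonym ('x, 'k) polynomial = "('x \<Rightarrow>\<^sub>0 nat) \<Rightarrow>\<^sub>0 'k"

definition monom :: "('x \<Rightarrow>\<^sub>0 nat) \<Rightarrow> ('x, 'k::comm_ring_1) polynomial" where
  "monom u = Poly_Mapping.single u 1"

definition divides :: "('x \<Rightarrow>\<^sub>0 nat) \<Rightarrow> ('x \<Rightarrow>\<^sub>0 nat) \<Rightarrow> bool" where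
  "divides u v \<longleftrightarrow> (\<exists>w. v = u + w)"

text \<open>The ideals of a commutative ring are the submodules of the ring as a module over itself.\<close>

lemma module_times: "module ((*) :: 'a::comm_ring_1 \<Rightarrow> 'a \<Rightarrow> 'a)"
  by unfold_locales (simp_all add: algebra_simps)

definition generated_ideal :: "'a::comm_ring_1 set \<Rightarrow> 'a set" where
  "generated_ideal B = module.span (*) B"

definition monomial_ideal :: "('x, 'k::comm_ring_1) polynomial set \<Rightarrow> bool" where
  "monomial_ideal I \<longleftrightarrow> (\<exists>L. I = generated_ideal (monom ` L))"

definition minimal_generators ::
    "('x, 'k::comm_ring_1) polynomial set \<Rightarrow> ('x \<Rightarrow>\<^sub>0 nat) set" where
  "minimal_generators I =
     (THE L. generated_ideal (monom ` L) = I \<and>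
             (\<forall>L'. L' \<subset> L \<longrightarrow> generated_ideal (monom ` L') \<noteq> I))"

definition dominant_in :: "('x \<Rightarrow>\<^sub>0 nat) \<Rightarrow> ('x \<Rightarrow>\<^sub>0 nat) set \<Rightarrow> bool" where
  "dominant_in v L \<longleftrightarrow>
     (\<exists>i. \<forall>w \<in> L - {v}. Poly_Mapping.lookup v i > Poly_Mapping.lookup w i)"

definition dominant_set :: "('x \<Rightarrow>\<^sub>0 nat) set \<Rightarrow> bool" where
  "dominant_set L \<longleftrightarrow> finite L \<and> (\<forall>v \<in> L. dominant_in v L)"

definition dominant_ideal :: "('x, 'k::comm_ring_1) polynomial set \<Rightarrow> bool" where
  "dominant_ideal I \<longleftrightarrow> monomial_ideal I \<and> dominant_set (minimal_generators I)"

definition is_lcm :: "('x \<Rightarrow>\<^sub>0 nat) \<Rightarrow> ('x \<Rightarrow>\<^sub>0 nat) set \<Rightarrow> bool" where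
  "is_lcm v L \<longleftrightarrow>
     (\<forall>u \<in> L. divides u v) \<and> (\<forall>w. (\<forall>u \<in> L. divides u w) \<longrightarrow> divides v w)"

text \<open>
  The lcm of an ideal is a relation, since the zero ideal has none (its empty set of minimal
  generators would satisfy \<open>is_lcm 0 {}\<close>).
\<close>

definition ideal_has_lcm ::
    "('x, 'k::comm_ring_1) polynomial set \<Rightarrow> ('x \<Rightarrow>\<^sub>0 nat) \<Rightarrow> bool" where
  "ideal_has_lcm I v \<longleftrightarrow> I \<noteq> {0} \<and> is_lcm v (minimal_generators I)"

text \<open>
  Four variables are indexed by the four-element type \<open>4\<close>, whose elements are \<open>1, 2, 3, 4\<close>
  (arithmetic there is modulo four, so \<open>4 = 0\<close>, but these four are distinct).
\<close>

definition monomial4 :: "nat \<Rightarrow> nat \<Rightarrow> nat \<Rightarrow> nat \<Rightarrow> (4 \<Rightarrow>\<^sub>0 nat)" where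
  "monomial4 m1 m2 m3 m4 =
     Poly_Mapping.single 1 m1 + Poly_Mapping.single 2 m2 +
     Poly_Mapping.single 3 m3 + Poly_Mapping.single 4 m4"

end

theory Submission
  imports Defs "HOL-Library.FuncSet" "HOL-Combinatorics.Multiset_Permutations"
begin

text \<open>
  A dominant set is an antichain for divisibility, so a dominant ideal amounts to a nonempty
  dominant set \<open>L\<close> of monomials. Choosing distinct variables in which its elements dominate
  shows that \<open>L\<close> has at most as many elements as there are variables. An enumeration of \<open>L\<close> is
  a matrix of exponents whose columns, one for each variable, have prescribed maxima; dominance
  says that each row contains the strict maximum of some column. Such matrices can be counted
  column by column: of the \<open>(m + 1)^q - m^q\<close> columns of length \<open>q\<close> with maximum \<open>m\<close>, exactly
  \<open>m^(q - 1)\<close> have their strict maximum in a given row. Each set of size \<open>q\<close> is enumerated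
  \<open>q!\<close> times.
\<close>

abbreviation "lookup \<equiv> Poly_Mapping.lookup"
abbreviation "keys \<equiv> Poly_Mapping.keys"

section \<open>Minimal generators of a monomial ideal\<close>

lemma divides_refl [simp]: "divides u u"
  unfolding divides_def by (rule exI[of _ 0]) simp

lemma divides_trans: "divides u v \<Longrightarrow> divides v w \<Longrightarrow> divides u w"
  unfolding divides_def by (metis add.assoc)

lemma divides_iff: "divides u v \<longleftrightarrow> (\<forall>i. lookup u i \<le> lookup v i)"
proof
  assume *: "\<forall>i. lookup u i \<le> lookup v i"
  have "v = u + (v - u)"
    by (rule poly_mapping_eqI) (use * in \<open>simp add: lookup_add lookup_minus\<close>)
  then show "divides u v" unfolding divides_def by blast
qed (auto simp: divides_def lookup_add)

lemma divides_antisym: "divides u v \<Longrightarrow> divides v u \<Longrightarrow> u = v"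
  by (rule poly_mapping_eqI) (simp add: divides_iff eq_iff)

text \<open>Each key of a multiple of \<open>monom l\<close> is \<open>l\<close> plus some exponent
  vector, and the keys of a sum lie among those of its summands. Span induction combines the
  two.\<close>

lemma keys_subset_of_mem_generated_ideal:
  fixes p :: "('x, 'k::comm_ring_1) polynomial"
  assumes "p \<in> generated_ideal (monom ` L)"
  shows "\<forall>u \<in> keys p. \<exists>l \<in> L. divides l u"
  using assms unfolding generated_ideal_def
proof (induct rule: module.span_induct_alt[OF module_times, consumes 1])
  case 1
  then show ?case by simp
next
  case (2 c x y)
  then obtain l where l: "l \<in> L" and x: "x = monom l" by auto
  have "\<exists>l \<in> L. divides l u" if "u \<in> keys (c * x)" for u
    using that keys_mult[of c x] l
    by (force simp: x monom_def divides_def add.commute split: if_splits)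
  then show ?case using 2 keys_add[of "c * x" y] by blast
qed

lemma monom_mem_generated_ideal_iff:
  fixes L :: "('x \<Rightarrow>\<^sub>0 nat) set"
  shows "(monom u :: ('x, 'k::comm_ring_1) polynomial) \<in> generated_ideal (monom ` L)
    \<longleftrightarrow> (\<exists>l \<in> L. divides l u)"
proof
  assume "(monom u :: ('x, 'k) polynomial) \<in> generated_ideal (monom ` L)"
  from keys_subset_of_mem_generated_ideal[OF this]
  show "\<exists>l \<in> L. divides l u" by (simp add: monom_def)
next
  assume "\<exists>l \<in> L. divides l u"
  then obtain l w where "l \<in> L" and u: "u = l + w" by (auto simp: divides_def)
  then have "(monom l :: ('x, 'k) polynomial) \<in> generated_ideal (monom ` L)"
    unfolding generated_ideal_def by (intro module.span_base[OF module_times]) simp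
  then have "monom w * (monom l :: ('x, 'k) polynomial) \<in> generated_ideal (monom ` L)"
    unfolding generated_ideal_def by (intro module.span_scale[OF module_times])
  also have "monom w * (monom l :: ('x, 'k) polynomial) = monom u"
    by (simp add: monom_def mult_single u add.commute)
  finally show "(monom u :: ('x, 'k) polynomial) \<in> generated_ideal (monom ` L)" .
qed

text \<open>From here on, ideals are compared purely through divisibility of exponent
  vectors.\<close>

lemma generated_ideal_subset_iff:
  fixes L L' :: "('x \<Rightarrow>\<^sub>0 nat) set"
  shows "(generated_ideal (monom ` L) :: ('x, 'k::comm_ring_1) polynomial set)
      \<subseteq> generated_ideal (monom ` L') \<longleftrightarrow> (\<forall>l \<in> L. \<exists>l' \<in> L'. divides l' l)"
    (is "?I L \<subseteq> ?I L' \<longleftrightarrow> ?R")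
proof
  assume "?I L \<subseteq> ?I L'"
  moreover have "monom l \<in> ?I L" if "l \<in> L" for l
    using that divides_refl monom_mem_generated_ideal_iff by blast
  ultimately show ?R using monom_mem_generated_ideal_iff by blast
next
  assume ?R
  then have "monom ` L \<subseteq> ?I L'" using monom_mem_generated_ideal_iff by blast
  then show "?I L \<subseteq> ?I L'"
    unfolding generated_ideal_def
    by (intro module.span_minimal[OF module_times] module.subspace_span[OF module_times])
qed

definition antichain :: "('x \<Rightarrow>\<^sub>0 nat) set \<Rightarrow> bool" where
  "antichain L \<longleftrightarrow> (\<forall>u \<in> L. \<forall>v \<in> L. divides u v \<longrightarrow> u = v)"

lemma minimal_generators_eq:
  fixes L :: "('x \<Rightarrow>\<^sub>0 nat) set"
  assumes "antichain L"
  shows "minimal_generators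
    (generated_ideal (monom ` L) :: ('x, 'k::comm_ring_1) polynomial set) = L"
  unfolding minimal_generators_def
proof (rule the_equality, intro conjI allI impI)
  let ?I = "\<lambda>L. generated_ideal (monom ` L) :: ('x, 'k) polynomial set"
  fix L' assume "L' \<subset> L"
  then obtain l where l: "l \<in> L" "l \<notin> L'" "L' \<subseteq> L" by blast
  show "?I L' \<noteq> ?I L"
  proof
    assume "?I L' = ?I L"
    then have "?I L \<subseteq> ?I L'" by simp
    then obtain l' where "l' \<in> L'" "divides l' l" using l generated_ideal_subset_iff by blast
    with l assms show False unfolding antichain_def by blast
  qed
next
  let ?I = "\<lambda>L. generated_ideal (monom ` L) :: ('x, 'k) polynomial set"
  fix L' assume *: "?I L' = ?I L \<and> (\<forall>L''. L'' \<subset> L' \<longrightarrow> ?I L'' \<noteq> ?I L)"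
  have "?I L' \<subseteq> ?I L" "?I L \<subseteq> ?I L'" using * by auto
  then have 1: "\<forall>l \<in> L'. \<exists>l' \<in> L. divides l' l" and 2: "\<forall>l \<in> L. \<exists>l' \<in> L'. divides l' l"
    unfolding generated_ideal_subset_iff by auto
  have "L \<subseteq> L'"
  proof
    fix l assume l: "l \<in> L"
    with 2 obtain l' where l': "l' \<in> L'" "divides l' l" by blast
    with 1 obtain l'' where l'': "l'' \<in> L" "divides l'' l'" by blast
    with l l' assms have "l'' = l" unfolding antichain_def using divides_trans by blast
    with l' l'' show "l \<in> L'" using divides_antisym by blast
  qed
  with * show "L' = L" by blast
qed simp

text \<open>The divisibility-minimal elements of any generating set still generate the ideal: total
  degree drops strictly along proper divisors, so descent from a generator ends at a minimal
  one.\<close>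

lemma monomial_ideal_antichain:
  fixes I :: "('x, 'k::comm_ring_1) polynomial set"
  assumes "monomial_ideal I"
  obtains L where "antichain L" "I = generated_ideal (monom ` L)"
proof -
  from assms obtain M where M: "I = generated_ideal (monom ` M)"
    by (auto simp: monomial_ideal_def)
  define L where "L = {u \<in> M. \<forall>v \<in> M. divides v u \<longrightarrow> v = u}"
  define deg where "deg u = (\<Sum>i \<in> keys u. lookup u i)" for u :: "'x \<Rightarrow>\<^sub>0 nat"
  have deg: "deg u < deg v" if "divides u v" "u \<noteq> v" for u v
  proof -
    have le: "\<forall>i. lookup u i \<le> lookup v i" using that by (simp add: divides_iff)
    then have sub: "keys u \<subseteq> keys v" by (metis in_keys_iff le_zero_eq subsetI)
    \<comment> \<open>Enlarging the index set adds only zeros and puts both degrees over the same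
      keys.\<close>
    then have "deg u = (\<Sum>i \<in> keys v. lookup u i)"
      unfolding deg_def by (intro sum.mono_neutral_left) (auto simp: in_keys_iff)
    also have "\<dots> < deg v" unfolding deg_def
    proof (rule sum_strict_mono_ex1)
      obtain i where "lookup u i \<noteq> lookup v i" using \<open>u \<noteq> v\<close> by (metis poly_mapping_eqI)
      with le have "lookup u i < lookup v i" by (simp add: le_neq_implies_less)
      then show "\<exists>i \<in> keys v. lookup u i < lookup v i"
        by (intro bexI[of _ i]) (auto simp: in_keys_iff)
    qed (use le in auto)
    finally show ?thesis .
  qed
  have "\<exists>l \<in> L. divides l u" if "u \<in> M" for u
    using that
  proof (induction "deg u" arbitrary: u rule: less_induct)
    case less
    show ?case
    proof (cases "u \<in> L")
      case True
      then show ?thesis using divides_refl by blast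
    next
      case False
      with less.prems obtain v where v: "v \<in> M" "divides v u" "v \<noteq> u" by (auto simp: L_def)
      with less.hyps[OF deg[OF v(2,3)] v(1)] show ?thesis using divides_trans by blast
    qed
  qed
  then have "I \<subseteq> generated_ideal (monom ` L)" unfolding M generated_ideal_subset_iff by blast
  moreover have "generated_ideal (monom ` L) \<subseteq> I"
    unfolding M generated_ideal_subset_iff L_def using divides_refl by blast
  moreover have "antichain L" by (auto simp: antichain_def L_def)
  ultimately show ?thesis using that by blast
qed

section \<open>Dominant ideals and dominant sets\<close>

definition dominant_sets_with_lcm :: "('x \<Rightarrow>\<^sub>0 nat) \<Rightarrow> ('x \<Rightarrow>\<^sub>0 nat) set set" where
  "dominant_sets_with_lcm m = {L. L \<noteq> {} \<and> dominant_set L \<and> is_lcm m L}"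

text \<open>A proper multiple \<open>v\<close> of \<open>u\<close> in \<open>L\<close> would be at
  least as large as \<open>u\<close> in every variable, including the one where \<open>u\<close>
  dominates.\<close>

lemma dominant_set_antichain:
  assumes "dominant_set L"
  shows "antichain L"
  unfolding antichain_def
proof (intro ballI impI)
  fix u v assume "u \<in> L" "v \<in> L" "divides u v"
  with assms obtain i where "\<forall>w \<in> L - {u}. lookup u i > lookup w i"
    by (auto simp: dominant_set_def dominant_in_def)
  with \<open>v \<in> L\<close> \<open>divides u v\<close> show "u = v"
    unfolding divides_iff by (metis DiffI leD singletonD)
qed

lemma generated_ideal_eq_zero_iff:
  fixes L :: "('x \<Rightarrow>\<^sub>0 nat) set"
  shows "(generated_ideal (monom ` L) :: ('x, 'k::comm_ring_1) polynomial set) = {0} \<longleftrightarrow> L = {}"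
proof
  assume *: "(generated_ideal (monom ` L) :: ('x, 'k) polynomial set) = {0}"
  show "L = {}"
  proof (rule ccontr)
    assume "L \<noteq> {}"
    then obtain l where "l \<in> L" by blast
    then have "(monom l :: ('x, 'k) polynomial) \<in> generated_ideal (monom ` L)"
      using divides_refl monom_mem_generated_ideal_iff by blast
    then have "(monom l :: ('x, 'k) polynomial) = 0" using * by blast
    then have "lookup (monom l :: ('x, 'k) polynomial) l = 0" by simp
    then show False by (simp add: monom_def)
  qed
qed (simp add: generated_ideal_def module.span_empty[OF module_times])

text \<open>Injective because an antichain is recovered from its ideal by
  \<open>minimal_generators\<close>; surjective because every monomial ideal has an antichain of
  generators.\<close>

lemma bij_betw_dominant_ideals:
  "bij_betw (\<lambda>L. generated_ideal (monom ` L)) (dominant_sets_with_lcm m)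
     {I :: ('x, 'k::comm_ring_1) polynomial set. dominant_ideal I \<and> ideal_has_lcm I m}"
proof (rule bij_betwI')
  fix L L' :: "('x \<Rightarrow>\<^sub>0 nat) set"
  assume "L \<in> dominant_sets_with_lcm m" "L' \<in> dominant_sets_with_lcm m"
  then have "antichain L" "antichain L'"
    by (auto simp: dominant_sets_with_lcm_def dominant_set_antichain)
  then show "(generated_ideal (monom ` L) = (generated_ideal (monom ` L') ::
      ('x, 'k) polynomial set)) \<longleftrightarrow> L = L'"
    using minimal_generators_eq by metis
next
  fix L :: "('x \<Rightarrow>\<^sub>0 nat) set"
  assume "L \<in> dominant_sets_with_lcm m"
  then show "generated_ideal (monom ` L) \<in>
      {I :: ('x, 'k) polynomial set. dominant_ideal I \<and> ideal_has_lcm I m}"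
    by (auto simp: dominant_sets_with_lcm_def dominant_ideal_def ideal_has_lcm_def
        monomial_ideal_def minimal_generators_eq[OF dominant_set_antichain]
        generated_ideal_eq_zero_iff)
next
  fix I :: "('x, 'k) polynomial set"
  assume I: "I \<in> {I. dominant_ideal I \<and> ideal_has_lcm I m}"
  then obtain L where L: "antichain L" "I = generated_ideal (monom ` L)"
    by (auto simp: dominant_ideal_def elim: monomial_ideal_antichain)
  have "L \<in> dominant_sets_with_lcm m"
    using I unfolding L(2)
    by (auto simp: dominant_ideal_def ideal_has_lcm_def dominant_sets_with_lcm_def
        minimal_generators_eq[OF L(1)] generated_ideal_eq_zero_iff)
  with L show "\<exists>L \<in> dominant_sets_with_lcm m. I = generated_ideal (monom ` L)" by blast
qed

lemma is_lcm_iff: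
  assumes "L \<noteq> {}"
  shows "is_lcm m L \<longleftrightarrow> (\<forall>i. (\<forall>u \<in> L. lookup u i \<le> lookup m i) \<and> (\<exists>u \<in> L. lookup u i = lookup m i))"
    (is "_ \<longleftrightarrow> ?R")
proof
  assume *: "is_lcm m L"
  then have le: "lookup u i \<le> lookup m i" if "u \<in> L" for u i
    using that by (auto simp: is_lcm_def divides_iff)
  show ?R
  proof (intro allI conjI ballI)
    fix i
    show "\<exists>u \<in> L. lookup u i = lookup m i"
    proof (rule ccontr)
      assume "\<not> ?thesis"
      then have lt: "\<forall>u \<in> L. lookup u i < lookup m i" using le le_neq_implies_less by blast
      \<comment> \<open>If no element of \<open>L\<close> attains the exponent of \<open>m\<close>
        at \<open>i\<close>, lowering it by one still leaves a common multiple, against minimality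
        of \<open>m\<close>.\<close>
      define w where "w = m - Poly_Mapping.single i 1"
      have "divides u w" if "u \<in> L" for u
        using lt le that
        by (auto simp: divides_iff w_def lookup_minus lookup_single when_def)
      with * have "divides m w" by (auto simp: is_lcm_def)
      then have "lookup m i \<le> lookup m i - 1"
        by (auto simp: divides_iff w_def lookup_minus dest: spec[of _ i])
      \<comment> \<open>Subtraction is truncated, so the preceding inequality is absurd only for a
        positive exponent; an element of \<open>L\<close> lying strictly below provides
        this.\<close>
      moreover have "lookup m i > 0" using lt assms by force
      ultimately show False by simp
    qed
  qed (rule le)
next
  assume R: ?R
  show "is_lcm m L"
    unfolding is_lcm_def divides_iff using R by metis
qed

lemma finite_dominant_sets_with_lcm:
  fixes m :: "'x::finite \<Rightarrow>\<^sub>0 nat"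
  shows "finite (dominant_sets_with_lcm m)"
proof (rule finite_subset)
  let ?D = "{u. \<forall>i. lookup u i \<le> lookup m i}"
  show "dominant_sets_with_lcm m \<subseteq> Pow ?D"
    by (auto simp: dominant_sets_with_lcm_def is_lcm_def divides_iff)
  have "finite (PiE UNIV (\<lambda>i. {..lookup m i}))" by (intro finite_PiE) auto
  moreover have "lookup ` ?D \<subseteq> PiE UNIV (\<lambda>i. {..lookup m i})" by auto
  ultimately have "finite (lookup ` ?D)" by (rule rev_finite_subset)
  then have "finite ?D"
    by (rule finite_imageD) (auto intro!: inj_onI poly_mapping_eqI)
  then show "finite (Pow ?D)" by simp
qed

text \<open>Two distinct elements cannot dominate in the same variable, so choosing a variable for
  each element is injective.\<close>

lemma card_dominant_set_le:
  fixes L :: "('x::finite \<Rightarrow>\<^sub>0 nat) set"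
  assumes "dominant_set L"
  shows "card L \<le> CARD('x)"
proof -
  from assms have "\<forall>v \<in> L. \<exists>i. \<forall>w \<in> L - {v}. lookup v i > lookup w i"
    by (auto simp: dominant_set_def dominant_in_def)
  then obtain f where f: "\<forall>v \<in> L. \<forall>w \<in> L - {v}. lookup v (f v) > lookup w (f v)" by metis
  have "inj_on f L"
  proof (rule inj_onI, rule ccontr)
    fix v w assume "v \<in> L" "w \<in> L" "f v = f w" "v \<noteq> w"
    with f have "lookup v (f v) > lookup w (f v)" "lookup w (f w) > lookup v (f w)" by auto
    with \<open>f v = f w\<close> show False by simp
  qed
  then show ?thesis by (rule card_inj_on_le) auto
qed

section \<open>Counting exponent matrices column by column\<close>

definition columns :: "nat \<Rightarrow> nat \<Rightarrow> (nat \<Rightarrow> nat) set" where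
  "columns q m = {c \<in> {..<q} \<rightarrow>\<^sub>E {..m}. \<exists>k<q. c k = m}"

text \<open>For \<open>q = 1\<close> row 0 is a peak vacuously, in line with one-element sets being
  dominant.\<close>

definition peak :: "nat \<Rightarrow> (nat \<Rightarrow> nat) \<Rightarrow> nat \<Rightarrow> bool" where
  "peak q c j \<longleftrightarrow> (\<forall>k<q. k \<noteq> j \<longrightarrow> c k < c j)"

text \<open>Both the columns \<open>V\<close> and the rows \<open>J\<close> that require a peak are
  parameters, so that removing a column gives an instance of the same problem.\<close>

definition peaked_matrices ::
    "nat \<Rightarrow> ('x \<Rightarrow> nat) \<Rightarrow> 'x set \<Rightarrow> nat set \<Rightarrow> ('x \<Rightarrow> nat \<Rightarrow> nat) set" where
  "peaked_matrices q m V J =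
     {C \<in> PiE V (\<lambda>i. columns q (m i)). \<forall>j \<in> J. \<exists>i \<in> V. peak q (C i) j}"

lemma finite_columns [simp]: "finite (columns q m)"
  unfolding columns_def by (rule finite_subset[OF _ finite_PiE[of "{..<q}" "\<lambda>_. {..m}"]]) auto

text \<open>Columns bounded by \<open>m\<close>, minus those that stay below \<open>m\<close>
  throughout. The integers keep the later differences from being truncated.\<close>

lemma card_columns: "int (card (columns q m)) = int (m + 1) ^ q - int m ^ q"
proof -
  have "c \<in> {..<q} \<rightarrow>\<^sub>E {..<m} \<longleftrightarrow> (\<forall>k<q. c k \<noteq> m)" if "c \<in> {..<q} \<rightarrow>\<^sub>E {..m}" for c
    using that by (auto simp: PiE_iff order.strict_iff_order)
  then have "columns q m = ({..<q} \<rightarrow>\<^sub>E {..m}) - ({..<q} \<rightarrow>\<^sub>E {..<m})"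
    unfolding columns_def by blast
  moreover have "({..<q} \<rightarrow>\<^sub>E {..<m}) \<subseteq> ({..<q} \<rightarrow>\<^sub>E {..m})" by (rule PiE_mono) auto
  ultimately have "card (columns q m) = (m + 1) ^ q - m ^ q"
    by (simp add: card_Diff_subset finite_PiE card_PiE)
  then show ?thesis by (simp add: of_nat_diff power_mono)
qed

text \<open>The peak must carry the maximum \<open>m\<close>, and each of the other
  \<open>q - 1\<close> rows takes any of the \<open>m\<close> smaller values.\<close>

lemma card_columns_peak:
  assumes "j < q"
  shows "card {c \<in> columns q m. peak q c j} = m ^ (q - 1)"
proof -
  have "{c \<in> columns q m. peak q c j} = PiE {..<q} (\<lambda>k. if k = j then {m} else {..<m})"
    (is "?A = ?B")
  proof
    show "?A \<subseteq> ?B"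
    proof
      fix c assume "c \<in> ?A"
      then obtain k where c: "c \<in> {..<q} \<rightarrow>\<^sub>E {..m}" "k < q" "c k = m" "peak q c j"
        by (auto simp: columns_def)
      have "c j \<le> m" using c assms by auto
      then have "c j = m" using c by (force simp: peak_def)
      with c show "c \<in> ?B" by (auto simp: PiE_iff peak_def)
    qed
    show "?B \<subseteq> ?A"
      using assms by (force simp: PiE_iff columns_def peak_def split: if_splits)
  qed
  then have "card ?A = (\<Prod>k<q. card (if k = j then {m} else {..<m}))" by (simp add: card_PiE)
  also have "\<dots> = (\<Prod>k \<in> {..<q} - {j}. m)"
    using assms by (subst prod.remove[of _ j]) (auto intro!: prod.cong)
  also have "\<dots> = m ^ (q - 1)" using assms by simp
  finally show ?thesis .
qed

lemma peak_unique: "peak q c j \<Longrightarrow> peak q c k \<Longrightarrow> j < q \<Longrightarrow> k < q \<Longrightarrow> j = k"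
  unfolding peak_def by (metis less_asym)

lemma finite_peaked_matrices: "finite V \<Longrightarrow> finite (peaked_matrices q m V J)"
  unfolding peaked_matrices_def
  by (rule finite_subset[OF _ finite_PiE[of V "\<lambda>i. columns q (m i)"]]) auto

text \<open>Matrices are sorted by their column \<open>c\<close> at \<open>v\<close>. Rows where
  \<open>c\<close> peaks are settled; the other rows of \<open>J\<close> need a peak within
  \<open>V\<close>.\<close>

lemma card_peaked_matrices_insert:
  assumes V: "finite V" "v \<notin> V"
  shows "card (peaked_matrices q m (insert v V) J) =
    (\<Sum>c \<in> columns q (m v). card (peaked_matrices q m V (J - Collect (peak q c))))"
proof -
  let ?S = "SIGMA c:columns q (m v). peaked_matrices q m V (J - Collect (peak q c))"
  let ?f = "\<lambda>(c, C). C(v := c)"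
  have inj: "inj_on ?f ?S"
    by (rule inj_on_subset[OF inj_combinator[OF V(2), of "\<lambda>i. columns q (m i)"]])
      (auto simp: peaked_matrices_def)
  have upd: "C(v := c) \<in> peaked_matrices q m (insert v V) J \<longleftrightarrow>
      C \<in> peaked_matrices q m V (J - Collect (peak q c))"
    if "c \<in> columns q (m v)" "C \<in> PiE V (\<lambda>i. columns q (m i))" for c C
  proof -
    have "C(v := c) \<in> PiE (insert v V) (\<lambda>i. columns q (m i))"
      using that by (auto simp: PiE_iff extensional_def)
    moreover have "(\<exists>i \<in> insert v V. peak q ((C(v := c)) i) j) \<longleftrightarrow>
        peak q c j \<or> (\<exists>i \<in> V. peak q (C i) j)" for j
      using V(2) by auto
    ultimately show ?thesis using that by (auto simp: peaked_matrices_def)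
  qed
  have "peaked_matrices q m (insert v V) J = ?f ` ?S"
  proof
    show "?f ` ?S \<subseteq> peaked_matrices q m (insert v V) J"
    proof clarify
      fix c C assume "c \<in> columns q (m v)"
        and C: "C \<in> peaked_matrices q m V (J - Collect (peak q c))"
      moreover from C have "C \<in> PiE V (\<lambda>i. columns q (m i))" by (simp add: peaked_matrices_def)
      ultimately show "C(v := c) \<in> peaked_matrices q m (insert v V) J" using upd by blast
    qed
    show "peaked_matrices q m (insert v V) J \<subseteq> ?f ` ?S"
    proof
      fix D assume D: "D \<in> peaked_matrices q m (insert v V) J"
      then have "D \<in> PiE (insert v V) (\<lambda>i. columns q (m i))" by (simp add: peaked_matrices_def)
      then obtain c C where cC: "D = C(v := c)" "c \<in> columns q (m v)"
          "C \<in> PiE V (\<lambda>i. columns q (m i))"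
        unfolding PiE_insert_eq by auto
      then have "(c, C) \<in> ?S" using upd D by auto
      then show "D \<in> ?f ` ?S" using cC by force
    qed
  qed
  then have "card (peaked_matrices q m (insert v V) J) = card ?S"
    using card_image[OF inj] by simp
  also have "\<dots> = (\<Sum>c \<in> columns q (m v). card (peaked_matrices q m V (J - Collect (peak q c))))"
    by (rule card_SigmaI) (auto simp: finite_peaked_matrices V)
  finally show ?thesis .
qed

text \<open>
  In the recursive step, a column has its strict maximum either in one of the \<open>k\<close> rows that
  still need one, which leaves \<open>k - 1\<close> such rows, or in none of them.
\<close>

fun peaked_count :: "nat \<Rightarrow> nat list \<Rightarrow> nat \<Rightarrow> int" where
  "peaked_count q [] k = (if k = 0 then 1 else 0)"
| "peaked_count q (m # ms) k =
     int k * int m ^ (q - 1) * peaked_count q ms (k - 1) +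
     (int (m + 1) ^ q - int m ^ q - int k * int m ^ (q - 1)) * peaked_count q ms k"

text \<open>A column peaks in at most one row, so the classes \<open>?P j\<close> are disjoint and a
  peak settles exactly one row of \<open>J\<close>. Hence only the size of \<open>J\<close>
  matters.\<close>

lemma card_peaked_matrices:
  assumes "distinct vs" "J \<subseteq> {..<q}"
  shows "int (card (peaked_matrices q m (set vs) J)) = peaked_count q (map m vs) (card J)"
  using assms
proof (induction vs arbitrary: J)
  case Nil
  have "finite J" using Nil finite_subset by blast
  then show ?case by (cases "J = {}") (auto simp: peaked_matrices_def)
next
  case (Cons v vs)
  let ?n = "\<lambda>J. int (card (peaked_matrices q m (set vs) J))"
  let ?P = "\<lambda>j. {c \<in> columns q (m v). peak q c j}"
  \<comment> \<open>This includes columns that peak in a row outside \<open>J\<close>, as well as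
    those with a tied maximum.\<close>
  let ?R = "columns q (m v) - (\<Union>j \<in> J. ?P j)"
  have J: "finite J" using Cons.prems finite_subset by blast
  have disj: "\<forall>i \<in> J. \<forall>j \<in> J. i \<noteq> j \<longrightarrow> ?P i \<inter> ?P j = {}"
    using Cons.prems peak_unique by blast
  have fin: "\<forall>j \<in> J. finite (?P j)" by simp
  have cardP: "card (?P j) = m v ^ (q - 1)" if "j \<in> J" for j
    using that Cons.prems by (intro card_columns_peak) auto
  have cardU: "card (\<Union>j \<in> J. ?P j) = card J * m v ^ (q - 1)"
    using card_UN_disjoint[OF J fin disj] cardP by simp
  have sub: "(\<Union>j \<in> J. ?P j) \<subseteq> columns q (m v)" by auto
  have cardR: "int (card ?R) =
      int (m v + 1) ^ q - int (m v) ^ q - int (card J) * int (m v) ^ (q - 1)"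
    using sub card_mono[OF finite_columns sub] finite_subset[OF sub] card_columns[of q "m v"]
    by (simp add: card_Diff_subset of_nat_diff cardU)
  have peakJ: "?n (J - Collect (peak q c)) = peaked_count q (map m vs) (card J - 1)"
    if "j \<in> J" "c \<in> ?P j" for j c
  proof -
    have "J - Collect (peak q c) = J - {j}" using that Cons.prems peak_unique by blast
    moreover have "?n (J - {j}) = peaked_count q (map m vs) (card (J - {j}))"
      using Cons.prems by (intro Cons.IH) auto
    ultimately show ?thesis using that J by simp
  qed
  have restJ: "?n (J - Collect (peak q c)) = peaked_count q (map m vs) (card J)"
    if "c \<in> ?R" for c
  proof -
    have "J - Collect (peak q c) = J" using that by auto
    then show ?thesis using Cons by simp
  qed
  have "int (card (peaked_matrices q m (set (v # vs)) J)) =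
      (\<Sum>c \<in> columns q (m v). ?n (J - Collect (peak q c)))"
    using Cons.prems by (simp add: card_peaked_matrices_insert)
  also have "\<dots> = (\<Sum>c \<in> (\<Union>j \<in> J. ?P j). ?n (J - Collect (peak q c))) +
      (\<Sum>c \<in> ?R. ?n (J - Collect (peak q c)))"
    using sum.subset_diff[OF sub finite_columns] by (simp add: add.commute)
  also have "(\<Sum>c \<in> (\<Union>j \<in> J. ?P j). ?n (J - Collect (peak q c))) =
      (\<Sum>c \<in> (\<Union>j \<in> J. ?P j). peaked_count q (map m vs) (card J - 1))"
    using peakJ by (intro sum.cong) auto
  also have "\<dots> = int (card J) * int (m v) ^ (q - 1) * peaked_count q (map m vs) (card J - 1)"
    by (simp only: sum_constant cardU) simp
  also have "(\<Sum>c \<in> ?R. ?n (J - Collect (peak q c))) =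
      (\<Sum>c \<in> ?R. peaked_count q (map m vs) (card J))"
    using restJ by (intro sum.cong) auto
  also have "\<dots> = (int (m v + 1) ^ q - int (m v) ^ q - int (card J) * int (m v) ^ (q - 1)) *
      peaked_count q (map m vs) (card J)"
    by (simp only: sum_constant cardR)
  finally show ?case by simp
qed

section \<open>Enumerations of dominant sets as matrices\<close>

text \<open>The variable comes first, so that partial application yields a column; the restriction
  makes it extensional, as \<open>columns\<close> demands.\<close>

definition exponent_matrix :: "('x \<Rightarrow>\<^sub>0 nat) list \<Rightarrow> 'x \<Rightarrow> nat \<Rightarrow> nat" where
  "exponent_matrix us i = (\<lambda>j \<in> {..<length us}. lookup (us ! j) i)"

lemma exponent_matrix_columns_iff:
  assumes "us \<noteq> []"
  shows "(\<forall>i. exponent_matrix us i \<in> columns (length us) (lookup m i)) \<longleftrightarrow> is_lcm m (set us)"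
proof -
  have rows: "set us = (!) us ` {..<length us}" by (auto simp: set_conv_nth)
  have "exponent_matrix us i \<in> columns (length us) (lookup m i) \<longleftrightarrow>
      (\<forall>u \<in> set us. lookup u i \<le> lookup m i) \<and> (\<exists>u \<in> set us. lookup u i = lookup m i)" for i
    by (auto simp: columns_def exponent_matrix_def PiE_iff rows)
  then show ?thesis using assms by (simp add: is_lcm_iff)
qed

text \<open>Distinctness lets the other row indices stand for the other elements of the set.\<close>

lemma peak_exponent_matrix_iff:
  assumes "distinct us" "j < length us"
  shows "peak (length us) (exponent_matrix us i) j \<longleftrightarrow>
    (\<forall>w \<in> set us - {us ! j}. lookup (us ! j) i > lookup w i)"
proof -
  have "set us - {us ! j} = (!) us ` ({..<length us} - {j})"
    using assms by (auto simp: in_set_conv_nth nth_eq_iff_index_eq)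
  then show ?thesis using assms(2) by (auto simp: peak_def exponent_matrix_def)
qed

text \<open>Two equal rows would agree in every column, so neither could hold a strict
  maximum.\<close>

lemma distinct_if_peaks:
  assumes "\<forall>j < length us. \<exists>i. peak (length us) (exponent_matrix us i) j"
  shows "distinct us"
  unfolding distinct_conv_nth
proof (intro allI impI notI)
  fix j k assume jk: "j < length us" "k < length us" "j \<noteq> k" "us ! j = us ! k"
  with assms obtain i where "peak (length us) (exponent_matrix us i) j" by blast
  with jk show False by (auto simp: peak_def exponent_matrix_def)
qed

lemma bij_betw_exponent_matrix:
  fixes m :: "'x::finite \<Rightarrow>\<^sub>0 nat"
  assumes "q > 0"
  shows "bij_betw exponent_matrix
    {us. distinct us \<and> length us = q \<and> set us \<in> dominant_sets_with_lcm m}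
    (peaked_matrices q (lookup m) UNIV {..<q})" (is "bij_betw _ ?A ?B")
proof (rule bij_betwI')
  fix us vs assume "us \<in> ?A" "vs \<in> ?A"
  then have l: "length us = q" "length vs = q" by auto
  show "exponent_matrix us = exponent_matrix vs \<longleftrightarrow> us = vs"
  proof
    assume eq: "exponent_matrix us = exponent_matrix vs"
    show "us = vs"
    proof (rule nth_equalityI)
      fix j assume "j < length us"
      then show "us ! j = vs ! j"
        using l fun_cong[OF fun_cong[OF eq], of _ j]
        by (intro poly_mapping_eqI) (simp add: exponent_matrix_def)
    qed (simp add: l)
  qed simp
next
  fix us assume us: "us \<in> ?A"
  then have "us \<noteq> []" using assms by auto
  moreover have "\<exists>i. peak q (exponent_matrix us i) j" if "j < q" for j
    using us that peak_exponent_matrix_iff[of us j]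
    by (fastforce simp: dominant_sets_with_lcm_def dominant_set_def dominant_in_def)
  ultimately show "exponent_matrix us \<in> ?B"
    using us exponent_matrix_columns_iff[of us m]
    by (auto simp: peaked_matrices_def dominant_sets_with_lcm_def PiE_iff)
next
  fix C assume C: "C \<in> ?B"
  \<comment> \<open>Row \<open>j\<close> of \<open>C\<close> is read back as a monomial; its support
    is finite because the type of variables is.\<close>
  define us where "us = map (\<lambda>j. Abs_poly_mapping (\<lambda>i. C i j)) [0..<q]"
  have len: "length us = q" by (simp add: us_def)
  have mat: "C = exponent_matrix us"
  proof (intro ext)
    fix i j
    show "C i j = exponent_matrix us i j"
      using C
      \<comment> \<open>For \<open>j\<close> outside the row range both sides are
        \<open>undefined\<close>.\<close>
      by (cases "j < q")
        (auto simp: exponent_matrix_def us_def peaked_matrices_def columns_def PiE_iff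
          extensional_def)
  qed
  have peaks: "\<forall>j < length us. \<exists>i. peak (length us) (exponent_matrix us i) j"
    using C mat len by (auto simp: peaked_matrices_def)
  then have dist: "distinct us" by (rule distinct_if_peaks)
  have "us \<noteq> []" using len assms by auto
  moreover have "dominant_set (set us)"
    unfolding dominant_set_def dominant_in_def
    using peaks peak_exponent_matrix_iff[OF dist] by (auto simp: in_set_conv_nth)
  moreover have "is_lcm m (set us)"
    using C mat len exponent_matrix_columns_iff[OF \<open>us \<noteq> []\<close>, of m]
    by (auto simp: peaked_matrices_def PiE_iff)
  ultimately have "us \<in> ?A" using dist len by (simp add: dominant_sets_with_lcm_def)
  with mat show "\<exists>us \<in> ?A. C = exponent_matrix us" by blast
qed

text \<open>Distinct lists are counted twice: grouped by their underlying set, and through their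
  exponent matrices. The list \<open>vs\<close> fixes the order in which the recursion consumes the
  columns.\<close>

lemma fact_mult_card_dominant_sets:
  fixes m :: "'x::finite \<Rightarrow>\<^sub>0 nat"
  assumes "q > 0" "distinct vs" "set vs = UNIV"
  shows "fact q * int (card {L \<in> dominant_sets_with_lcm m. card L = q}) =
    peaked_count q (map (lookup m) vs) q"
proof -
  let ?D = "{L \<in> dominant_sets_with_lcm m. card L = q}"
  let ?A = "{us. distinct us \<and> length us = q \<and> set us \<in> dominant_sets_with_lcm m}"
  have fin: "finite L" if "L \<in> ?D" for L
    using that by (auto simp: dominant_sets_with_lcm_def dominant_set_def)
  have "?A = (\<Union>L \<in> ?D. permutations_of_set L)"
    by (auto simp: permutations_of_set_def distinct_card)
  also have "card \<dots> = (\<Sum>L \<in> ?D. card (permutations_of_set L))"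
    by (rule card_UN_disjoint)
      (auto simp: finite_dominant_sets_with_lcm permutations_of_set_def[of _] 
        intro: finite_subset[OF _ finite_permutations_of_set])
  also have "\<dots> = (\<Sum>L \<in> ?D. fact q)"
    using fin by (intro sum.cong) auto
  also have "\<dots> = fact q * card ?D" by simp
  finally have "fact q * card ?D = card (peaked_matrices q (lookup m) UNIV {..<q})"
    using bij_betw_same_card[OF bij_betw_exponent_matrix[OF assms(1), of m]] by simp
  then have "int (fact q * card ?D) = peaked_count q (map (lookup m) vs) q"
    using card_peaked_matrices[OF assms(2), of "{..<q}" q "lookup m"] assms(3) by simp
  then show ?thesis by simp
qed

text \<open>Sizes start at 1 by nonemptiness and stop at the number of variables by
  \<open>card_dominant_set_le\<close>.\<close>

lemma card_dominant_sets_with_lcm: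
  fixes m :: "'x::finite \<Rightarrow>\<^sub>0 nat"
  shows "card (dominant_sets_with_lcm m) =
    (\<Sum>q = 1..CARD('x). card {L \<in> dominant_sets_with_lcm m. card L = q})"
proof -
  have "card L \<in> {1..CARD('x)}" if "L \<in> dominant_sets_with_lcm m" for L
    using that card_dominant_set_le[of L] card_0_eq[of L]
    by (auto simp: dominant_sets_with_lcm_def dominant_set_def Suc_le_eq)
  then have "dominant_sets_with_lcm m =
      (\<Union>q \<in> {1..CARD('x)}. {L \<in> dominant_sets_with_lcm m. card L = q})" by blast
  also have "card \<dots> = (\<Sum>q = 1..CARD('x). card {L \<in> dominant_sets_with_lcm m. card L = q})"
    by (rule card_UN_disjoint) (auto simp: finite_dominant_sets_with_lcm)
  finally show ?thesis .
qed

section \<open>The case of four variables\<close>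

lemma UNIV_4: "set [1, 2, 3, 4 :: 4] = UNIV"
proof -
  have "distinct [1, 2, 3, 4 :: 4]" by simp
  then have "card (set [1, 2, 3, 4 :: 4]) = CARD(4)" by (simp add: distinct_card)
  then show ?thesis by (intro card_subset_eq) auto
qed

theorem theorem3p11:
  fixes m1 m2 m3 m4 :: nat
  shows "card {I :: (4, 'k::field) polynomial set.
                 dominant_ideal I \<and> ideal_has_lcm I (monomial4 m1 m2 m3 m4)} =
    1 + (m1*m2*m3*m4)^3
    + (m1*m2 + m1*m3 + m1*m4 + m2*m3 + m2*m4 + m3*m4)
    + 3 * (m1*m2*m3 + m1*m2*m4 + m1*m3*m4 + m2*m3*m4)
    + 7 * (m1*m2*m3*m4)
    + (m1*m2*m3)^2 + (m1*m2*m4)^2 + (m1*m3*m4)^2 + (m2*m3*m4)^2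
    + 6 * (m1*m2*m3*m4)^2
    + 3 * (m1 * m2^2 * m3^2 * m4^2 + m1^2 * m2 * m3^2 * m4^2
           + m1^2 * m2^2 * m3 * m4^2 + m1^2 * m2^2 * m3^2 * m4)"
proof -
  let ?m = "monomial4 m1 m2 m3 m4"
  define d where "d q = int (card {L \<in> dominant_sets_with_lcm ?m. card L = q})" for q
  have lookups: "map (lookup ?m) [1, 2, 3, 4] = [m1, m2, m3, m4]"
    by (simp add: monomial4_def lookup_add lookup_single)
  have d: "fact q * d q = peaked_count q [m1, m2, m3, m4] q" if "q > 0" for q
    using fact_mult_card_dominant_sets[OF that _ UNIV_4, of ?m]
    unfolding d_def lookups by simp
  define a b c e where "a = int m1" and "b = int m2" and "c = int m3" and "e = int m4"
  note abce = a_def[symmetric] b_def[symmetric] c_def[symmetric] e_def[symmetric]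
  \<comment> \<open>For one row every column is peaked and determined: this is the principal
    ideal.\<close>
  have d1: "d 1 = 1"
    using d[of 1] by (simp add: abce)
  \<comment> \<open>By inclusion-exclusion the count is the product of all \<open>2*m + 1\<close>,
    minus twice the product of all \<open>m + 1\<close>, plus 1. A product of \<open>s\<close>
    exponents gets coefficient \<open>2^s - 2\<close>, which after halving is 1, 3 or 7 for
    \<open>s\<close> = 2, 3, 4.\<close>
  have d2: "2 * d 2 = 2 * (a*b + a*c + a*e + b*c + b*e + c*e
      + 3 * (a*b*c + a*b*e + a*c*e + b*c*e) + 7 * (a*b*c*e))"
    using d[of 2] by (simp add: fact_numeral abce power2_eq_square) (simp add: algebra_simps)
  \<comment> \<open>A column has \<open>m^2\<close> peaks per row and \<open>3*m + 1\<close>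
    unpeaked forms. Either three columns peak in distinct rows (6 ways) and the fourth is unpeaked,
    or all four peak and cover the three rows (36 ways).\<close>
  have d3: "6 * d 3 = 6 * ((a*b*c)^2 + (a*b*e)^2 + (a*c*e)^2 + (b*c*e)^2 + 6 * (a*b*c*e)^2
      + 3 * (a * b^2 * c^2 * e^2 + a^2 * b * c^2 * e^2 + a^2 * b^2 * c * e^2 + a^2 * b^2 * c^2 * e))"
    using d[of 3]
    by (simp add: fact_numeral abce power2_eq_square power3_eq_cube) (simp add: algebra_simps)
  \<comment> \<open>All four columns must peak, in distinct rows: 24 assignments with
    \<open>m^3\<close> choices per column.\<close>
  have d4: "24 * d 4 = 24 * (a*b*c*e)^3"
    using d[of 4] by (simp add: fact_numeral abce power_mult_distrib)
  have "{1..4::nat} = {1, 2, 3, 4}" by auto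
  then have "int (card (dominant_sets_with_lcm ?m)) = d 1 + d 2 + d 3 + d 4"
    unfolding card_dominant_sets_with_lcm d_def by simp
  also have "card (dominant_sets_with_lcm ?m) =
      card {I :: (4, 'k) polynomial set. dominant_ideal I \<and> ideal_has_lcm I ?m}"
    by (rule bij_betw_same_card[OF bij_betw_dominant_ideals])
  finally show ?thesis
    using d1 d2 d3 d4
    by (simp add: a_def b_def c_def e_def flip: of_nat_eq_iff[where ?'a = int])
qed

end
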